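(* Let $N\in\mathbb{N}$, $P\in\mathbb{R}\setminus\{0\}$, $Q\in\mathbb{R}$, and let $\alpha_o,\beta_o$ be positive real numbers. For each $l\in\{1,2,\dots,N\}$ let $\mu_l>0$, let $q_0^{(l)},p_0^{(l)}\in\mathbb{R}$, and let $\phi_l$ be a non-zero function in $L^2(\mathbb{R},dx)$ whose support is contained in an interval of length $\mu_l$. Assume that for each $l\in\{1,2,\dots,N\}$: (i) $p_0^{(l)}=\dfrac{2\pi}{P\mu_l}$; (ii) $|q_0^{(l)}p_0^{(l)}|<2\pi$, that is, $|q_0^{(l)}|<|P|\mu_l$; (iii) for almost all $x\in\mathbb{R}$, $$\frac{\alpha_o}{N\min_{1\le i\le N}\mu_i}\le\sum_{n\in\mathbb{Z}}\big|\phi_l\big(x-nq_0^{(l)}\big)\big|^2\le\frac{\beta_o}{N\max_{1\le i\le N}\mu_i}.$$ Then the collection $\{|\phi^{P,Q}_{(m,n,l)}\rangle\}_{m,n\in\mathbb{Z},\ l\in\{1,\dots,N\}}$ is a frame for $L^2(\mathbb{R},dx)$ with frame bounds $\alpha_o,\beta_o$, i.e. for all $f\in L^2(\mathbb{R},dx)$, $$\alpha_o\|f\|^2\le\sum_{l=1}^N\sum_{m,n\in\mathbb{Z}}|\langle f|\phi^{P,Q}_{(m,n,l)}\rangle|^2\le\beta_o\|f\|^2.$$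
   Context: The inner product on $L^2(\mathbb{R},dx)$ is $\langle\phi|\psi\rangle=\int_{\mathbb{R}}\overline{\phi(x)}\psi(x)\,dx$ and $\|\cdot\|$ is the usual $L^2$-norm. The Weyl-Heisenberg group is $\mathcal{W}=\mathbb{R}^2\rtimes_\psi\mathbb{R}$, where $\psi_\lambda((x_1,x_2))=(x_1+\lambda x_2,x_2)$, with multiplication $((x_1,x_2),\lambda)((y_1,y_2),\nu)=(\psi_\lambda(y_1,y_2)+(x_1,x_2),\lambda+\nu)$. For $P\in\mathbb{R}\setminus\{0\}$, $Q\in\mathbb{R}$, its unitary irreducible representation $\kappa^{P,Q}$ on $L^2(\mathbb{R},dx)$ is $$(\kappa^{P,Q}((u_1,u_2),z)f)(x)=e^{i[P(u_1+xu_2)+Qu_2]}f(z+x).$$ For $m,n\in\mathbb{Z}$ and $l\in\{1,\dots,N\}$, $$|\phi^{P,Q}_{(m,n,l)}\rangle=\kappa^{P,Q}\Big(\Big(\tfrac{mnq_0^{(l)}p_0^{(l)}}{2},\,mp_0^{(l)}\Big),\,nq_0^{(l)}\Big)\phi_l.$$ A collection $\{|\phi_{(m,n,l)}\rangle\}_{m,n\in\mathbb{Z},\,l\in\{1,\dots,N\}}$ in a Hilbert space $\mathcal{H}$ is a frame for $\mathcal{H}$ (also called a multivariate frame) with lower and upper frame bounds $\alpha_o,\beta_o>0$ if $\alpha_o\|f\|^2\le\sum_{l=1}^N\sum_{m,n\in\mathbb{Z}}|\langle f|\phi_{(m,n,l)}\rangle|^2\le\beta_o\|f\|^2$ for all $f\in\mathcal{H}$.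 Frame bounds are not required to be optimal. *)

theory Defs
  imports "HOL-Analysis.Analysis"
begin

text \<open>
  Elements of \<open>L\<^sup>2(\<real>, dx)\<close> are handled through representatives: Lebesgue measurable functions
  whose squared modulus is integrable. Every notion below that is applied to them is invariant
  under modification on a null set.
\<close>

definition L2 :: "(real \<Rightarrow> complex) set" where
  "L2 = {f. f \<in> borel_measurable lebesgue \<and> integrable lebesgue (\<lambda>x. (cmod (f x))\<^sup>2)}"

definition L2_inner :: "(real \<Rightarrow> complex) \<Rightarrow> (real \<Rightarrow> complex) \<Rightarrow> complex" where
  "L2_inner f g = (LINT x|lebesgue. cnj (f x) * g x)"

definition L2_norm :: "(real \<Rightarrow> complex) \<Rightarrow> real" where
  "L2_norm f = sqrt (LINT x|lebesgue. (cmod (f x))\<^sup>2)"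

text \<open>
  The support of a function defined up to null sets: the complement of the largest open set on
  which it vanishes almost everywhere.
\<close>

definition L2_support :: "(real \<Rightarrow> complex) \<Rightarrow> real set" where
  "L2_support f = - \<Union>{U. open U \<and> (AE x in lebesgue. x \<in> U \<longrightarrow> f x = 0)}"

text \<open>
  An element \<open>((u\<^sub>1, u\<^sub>2), z)\<close> of the Weyl-Heisenberg group is a nested pair of reals.
\<close>

type_synonym weyl_heisenberg = "(real \<times> real) \<times> real"

definition WH_action :: "real \<Rightarrow> real \<times> real \<Rightarrow> real \<times> real" where
  "WH_action z x = (fst x + z * snd x, snd x)"

definition WH_mult :: "weyl_heisenberg \<Rightarrow> weyl_heisenberg \<Rightarrow> weyl_heisenberg" where
  "WH_mult g h = (WH_action (snd g) (fst h) + fst g, snd g + snd h)"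

fun WH_rep :: "real \<Rightarrow> real \<Rightarrow> weyl_heisenberg \<Rightarrow> (real \<Rightarrow> complex) \<Rightarrow> real \<Rightarrow> complex" where
  "WH_rep P Q ((u1, u2), z) f x =
     exp (\<i> * complex_of_real (P * (u1 + x * u2) + Q * u2)) * f (z + x)"

lemma WH_rep_mult: "WH_rep P Q (WH_mult g h) f = WH_rep P Q g (WH_rep P Q h f)"
proof
  fix x
  obtain u1 u2 z v1 v2 w where gh: "g = ((u1, u2), z)" "h = ((v1, v2), w)"
    by (metis surj_pair)
  let ?a = "P * (u1 + x * u2) + Q * u2" and ?b = "P * (v1 + (z + x) * v2) + Q * v2"
  have "P * (v1 + z * v2 + u1 + x * (v2 + u2)) + Q * (v2 + u2) = ?a + ?b"
    by (simp add: algebra_simps)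
  then have "WH_rep P Q (WH_mult g h) f x = exp (\<i> * complex_of_real (?a + ?b)) * f (w + (z + x))"
    by (simp only: gh WH_mult_def WH_action_def fst_conv snd_conv add_Pair WH_rep.simps
        add.assoc add.left_commute)
  also have "exp (\<i> * complex_of_real (?a + ?b))
      = exp (\<i> * complex_of_real ?a) * exp (\<i> * complex_of_real ?b)"
    by (subst of_real_add, subst ring_distribs(1), rule exp_add)
  finally show "WH_rep P Q (WH_mult g h) f x = WH_rep P Q g (WH_rep P Q h f) x"
    by (simp only: gh WH_rep.simps mult.assoc)
qed

definition WH_vector ::
  "real \<Rightarrow> real \<Rightarrow> real \<Rightarrow> real \<Rightarrow> (real \<Rightarrow> complex) \<Rightarrow> int \<Rightarrow> int \<Rightarrow> real \<Rightarrow> complex" where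
  "WH_vector P Q p0 q0 \<phi> m n =
     WH_rep P Q ((of_int m * of_int n * q0 * p0 / 2, of_int m * p0), of_int n * q0) \<phi>"

text \<open>
  The frame series has nonnegative terms and is taken in \<^typ>\<open>ennreal\<close>, where it always has a
  value; the upper bound therefore includes convergence.
\<close>

definition L2_multivariate_frame ::
  "nat \<Rightarrow> (int \<Rightarrow> int \<Rightarrow> nat \<Rightarrow> real \<Rightarrow> complex) \<Rightarrow> real \<Rightarrow> real \<Rightarrow> bool" where
  "L2_multivariate_frame N \<Phi> \<alpha> \<beta> \<longleftrightarrow>
     0 < \<alpha> \<and> 0 < \<beta> \<and> (\<forall>m n. \<forall>l\<in>{1..N}. \<Phi> m n l \<in> L2) \<and>
     (\<forall>f\<in>L2.
        ennreal (\<alpha> * (L2_norm f)\<^sup>2)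
          \<le> (\<Sum>l=1..N. \<Sum>\<^sub>\<infinity>(m, n)\<in>UNIV. ennreal ((cmod (L2_inner f (\<Phi> m n l)))\<^sup>2)) \<and>
        (\<Sum>l=1..N. \<Sum>\<^sub>\<infinity>(m, n)\<in>UNIV. ennreal ((cmod (L2_inner f (\<Phi> m n l)))\<^sup>2))
          \<le> ennreal (\<beta> * (L2_norm f)\<^sup>2))"

end

theory Submission
  imports Defs
begin

text \<open>
  For fixed \<open>l\<close> and \<open>n\<close> the function \<open>h x = f x * cnj (\<phi> l (x + n q\<^sub>0))\<close> lives on an interval of length \<open>\<mu> l\<close>,
  and since \<open>P p\<^sub>0 = 2 \<pi> / \<mu> l\<close> the coefficients \<open>\<langle>f|\<phi>\<^sub>m\<^sub>n\<^sub>l\<rangle>\<close> are, up to conjugation and a phase, the Fourier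
  coefficients of \<open>h\<close> on that interval. Parseval's identity sums their squares over \<open>m\<close> to
  \<open>\<mu> l \<integral>|h|\<^sup>2\<close>; here \<open>h\<close> is square integrable because the upper bound (iii) makes \<open>\<phi> l\<close> essentially
  bounded. Summing over \<open>n\<close> gives \<open>\<mu> l \<integral>|f(x)|\<^sup>2 \<Sum>\<^sub>n |\<phi> l (x + n q\<^sub>0)|\<^sup>2 dx\<close>, which (iii) places between
  \<open>\<alpha>/N \<parallel>f\<parallel>\<^sup>2\<close> and \<open>\<beta>/N \<parallel>f\<parallel>\<^sup>2\<close>.
\<close>

subsection \<open>Sums in the extended nonnegative reals and square integrable functions\<close>

text \<open>Both sides are suprema of finite partial sums: a finite sum is an integral over a finite
  set, and an enumeration of the type turns the integral into a series. This makes integration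
  theorems available for the frame series.\<close>

lemma infsum_eq_nn_integral_count_space:
  fixes f :: "'a \<Rightarrow> ennreal"
  assumes "countable (UNIV :: 'a set)" "infinite (UNIV :: 'a set)"
  shows "(\<Sum>\<^sub>\<infinity>x\<in>UNIV. f x) = (\<integral>\<^sup>+x. f x \<partial>count_space UNIV)"
proof (rule antisym)
  have SUP: "(\<Sum>\<^sub>\<infinity>x\<in>UNIV. f x) = (SUP F\<in>{F. finite F \<and> F \<subseteq> UNIV}. sum f F)"
    by (intro nonneg_infsum_complete) simp
  show "(\<Sum>\<^sub>\<infinity>x\<in>UNIV. f x) \<le> (\<integral>\<^sup>+x. f x \<partial>count_space UNIV)"
    unfolding SUP
  proof (rule SUP_least)
    fix F :: "'a set" assume "F \<in> {F. finite F \<and> F \<subseteq> UNIV}"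
    then have "finite F" by simp
    then have "sum f F = (\<integral>\<^sup>+x. f x \<partial>count_space F)"
      by (simp add: nn_integral_count_space_finite)
    also have "\<dots> = (\<integral>\<^sup>+x. f x * indicator F x \<partial>count_space UNIV)"
      by (simp add: nn_integral_count_space_indicator)
    also have "\<dots> \<le> (\<integral>\<^sup>+x. f x \<partial>count_space UNIV)"
      by (intro nn_integral_mono) (auto simp: indicator_def)
    finally show "sum f F \<le> (\<integral>\<^sup>+x. f x \<partial>count_space UNIV)" .
  qed
  obtain e :: "nat \<Rightarrow> 'a" where e: "bij_betw e UNIV UNIV"
    using assms bij_betw_from_nat_into by blast
  have "(\<integral>\<^sup>+x. f x \<partial>count_space UNIV) = (\<integral>\<^sup>+n. f (e n) \<partial>count_space UNIV)"
    by (rule nn_integral_bij_count_space[OF e, symmetric])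
  also have "\<dots> = (\<Sum>n. f (e n))"
    by (rule nn_integral_count_space_nat)
  also have "\<dots> \<le> (\<Sum>\<^sub>\<infinity>x\<in>UNIV. f x)"
  proof (rule suminf_le_const[OF summableI])
    fix n
    have "(\<Sum>i<n. f (e i)) = sum f (e ` {..<n})"
      using e by (subst sum.reindex) (auto intro: inj_on_subset simp: bij_betw_def)
    also have "\<dots> \<le> (\<Sum>\<^sub>\<infinity>x\<in>UNIV. f x)"
      unfolding SUP by (intro SUP_upper) auto
    finally show "(\<Sum>i<n. f (e i)) \<le> (\<Sum>\<^sub>\<infinity>x\<in>UNIV. f x)" .
  qed
  finally show "(\<integral>\<^sup>+x. f x \<partial>count_space UNIV) \<le> (\<Sum>\<^sub>\<infinity>x\<in>UNIV. f x)" .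
qed

lemma infsum_int_eq_nn_integral:
  fixes f :: "int \<Rightarrow> ennreal"
  shows "(\<Sum>\<^sub>\<infinity>x\<in>UNIV. f x) = (\<integral>\<^sup>+x. f x \<partial>count_space UNIV)"
  by (intro infsum_eq_nn_integral_count_space) auto

text \<open>Tonelli for two counting measures. The translation index \<open>n\<close> is put
  outside, so that Parseval can be applied to the inner sum over modulations.\<close>

lemma infsum_int_int_ennreal:
  fixes f :: "int \<Rightarrow> int \<Rightarrow> ennreal"
  shows "(\<Sum>\<^sub>\<infinity>(m, n)\<in>UNIV. f m n) = (\<Sum>\<^sub>\<infinity>n\<in>UNIV. \<Sum>\<^sub>\<infinity>m\<in>UNIV. f m n)"
proof -
  have inf: "infinite (UNIV :: (int \<times> int) set)"
    by (simp add: finite_prod)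
  interpret int: sigma_finite_measure "count_space (UNIV :: int set)"
    by (intro sigma_finite_measure_count_space_countable) simp
  have "(\<Sum>\<^sub>\<infinity>(m, n)\<in>UNIV. f m n) = (\<integral>\<^sup>+z. (case z of (m, n) \<Rightarrow> f m n) \<partial>count_space UNIV)"
    by (intro infsum_eq_nn_integral_count_space inf) simp
  also have "\<dots> = (\<integral>\<^sup>+z. (case z of (m, n) \<Rightarrow> f m n) \<partial>(count_space UNIV \<Otimes>\<^sub>M count_space UNIV))"
    by (rule nn_integral_count_space_prod_eq[symmetric])
  also have "\<dots> = (\<integral>\<^sup>+m. \<integral>\<^sup>+n. f m n \<partial>count_space UNIV \<partial>count_space UNIV)"
    by (subst int.nn_integral_fst[symmetric]) (auto simp: pair_measure_countable)
  also have "\<dots> = (\<integral>\<^sup>+n. \<integral>\<^sup>+m. f m n \<partial>count_space UNIV \<partial>count_space UNIV)"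
    by (intro nn_integral_count_space_nn_integral) auto
  finally show ?thesis
    by (simp add: infsum_int_eq_nn_integral)
qed

section \<open>Square integrable functions over a general measure\<close>

definition square_integrable :: "'a measure \<Rightarrow> ('a \<Rightarrow> complex) \<Rightarrow> bool" where
  "square_integrable M f \<longleftrightarrow>
     f \<in> borel_measurable M \<and> integrable M (\<lambda>x. (cmod (f x))\<^sup>2)"

lemma square_integrableD:
  assumes "square_integrable M f"
  shows square_integrable_measurable: "f \<in> borel_measurable M"
    and square_integrable_integrable: "integrable M (\<lambda>x. (cmod (f x))\<^sup>2)"
  using assms by (auto simp: square_integrable_def)

lemma square_integrable_dominated:
  assumes "f \<in> borel_measurable M" "integrable M w" "AE x in M. (cmod (f x))\<^sup>2 \<le> w x"
  shows "square_integrable M f"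
proof -
  have "integrable M (\<lambda>x. (cmod (f x))\<^sup>2)"
  proof (rule Bochner_Integration.integrable_bound[OF assms(2)])
    show "AE x in M. norm ((cmod (f x))\<^sup>2) \<le> norm (w x)"
      using assms(3) by eventually_elim auto
  qed (use assms(1) in measurable)
  then show ?thesis using assms(1) by (simp add: square_integrable_def)
qed

lemma cmod_power2_add_le: "(cmod (u + v))\<^sup>2 \<le> 2 * (cmod u)\<^sup>2 + 2 * (cmod v)\<^sup>2"
proof -
  have "(cmod (u + v))\<^sup>2 \<le> (cmod u + cmod v)\<^sup>2"
    by (intro power_mono norm_triangle_ineq) auto
  also have "\<dots> \<le> 2 * (cmod u)\<^sup>2 + 2 * (cmod v)\<^sup>2"
    using sum_squares_bound[of "cmod u" "cmod v"] by (simp add: power2_sum)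
  finally show ?thesis .
qed

lemma square_integrable_add:
  assumes "square_integrable M f" "square_integrable M g"
  shows "square_integrable M (\<lambda>x. f x + g x)"
proof (rule square_integrable_dominated)
  show "integrable M (\<lambda>x. 2 * (cmod (f x))\<^sup>2 + 2 * (cmod (g x))\<^sup>2)"
    using assms by (simp add: square_integrable_def)
  show "(\<lambda>x. f x + g x) \<in> borel_measurable M"
    using assms by (auto simp: square_integrable_def)
qed (simp add: cmod_power2_add_le)

lemma square_integrable_cmult:
  "square_integrable M f \<Longrightarrow> square_integrable M (\<lambda>x. c * f x)"
  by (auto simp: square_integrable_def norm_mult power_mult_distrib)

lemma square_integrable_diff:
  assumes "square_integrable M f" "square_integrable M g"
  shows "square_integrable M (\<lambda>x. f x - g x)"
  using square_integrable_add[OF assms(1) square_integrable_cmult[OF assms(2), of "-1"]] by simp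

lemma square_integrable_cnj: "square_integrable M f \<Longrightarrow> square_integrable M (\<lambda>x. cnj (f x))"
  using measurable_compose[of f M borel cnj borel] borel_measurable_continuous_onI[of cnj]
  by (auto simp: square_integrable_def continuous_on_cnj)

lemma square_integrable_mult_integrable:
  assumes "square_integrable M f" "square_integrable M g"
  shows "integrable M (\<lambda>x. f x * g x)"
proof (rule Bochner_Integration.integrable_bound)
  show "integrable M (\<lambda>x. (cmod (f x))\<^sup>2 + (cmod (g x))\<^sup>2)"
    using assms by (auto simp: square_integrable_def)
  show "(\<lambda>x. f x * g x) \<in> borel_measurable M"
    using assms by (auto simp: square_integrable_def)
  have "cmod u * cmod v \<le> (cmod u)\<^sup>2 + (cmod v)\<^sup>2" for u v
    using sum_squares_bound[of "cmod u" "cmod v"] mult_nonneg_nonneg[OF norm_ge_zero[of u] norm_ge_zero[of v]]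
    by (simp only: mult.assoc)
  then show "AE x in M. norm (f x * g x) \<le> norm ((cmod (f x))\<^sup>2 + (cmod (g x))\<^sup>2)"
    by (simp add: norm_mult)
qed

text \<open>The union defining the support may be taken over countably many open sets.\<close>

lemma AE_L2_support_complement: "AE x in lebesgue. x \<notin> L2_support f \<longrightarrow> f x = 0"
proof -
  let ?F = "{U. open U \<and> (AE x in lebesgue. x \<in> U \<longrightarrow> f x = 0)}"
  obtain F' where F': "F' \<subseteq> ?F" "countable F'" "\<Union>F' = \<Union>?F"
    using Lindelof[of ?F] by auto
  have "AE x in lebesgue. \<forall>U\<in>F'. x \<in> U \<longrightarrow> f x = 0"
    using F'(1) by (subst AE_ball_countable[OF F'(2)]) auto
  then show ?thesis
  proof eventually_elim
    case (elim x)
    then show ?case using F'(3) by (metis (lifting) L2_support_def ComplI Union_iff)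
  qed
qed

subsection \<open>Parseval's identity on an interval\<close>

definition trig :: "real \<Rightarrow> int \<Rightarrow> real \<Rightarrow> complex" where
  "trig L k x = cis (2 * pi * of_int k * x / L)"

lemma trig_0 [simp]: "trig L 0 x = 1"
  by (simp add: trig_def)

lemma norm_trig [simp]: "cmod (trig L k x) = 1"
  by (simp add: trig_def)

lemma trig_add: "trig L (j + k) x = trig L j x * trig L k x"
  by (simp add: trig_def cis_mult ring_distribs add_divide_distrib)

lemma cnj_trig: "cnj (trig L k x) = trig L (- k) x"
  by (simp add: trig_def cis_cnj)

lemma continuous_on_trig [continuous_intros]: "continuous_on S (trig L k)"
  \<comment> \<open>Division by \<open>0\<close> yields \<open>0\<close>, so \<open>trig\<close> is
    constant for \<open>L = 0\<close>, where the continuity rule for quotients does not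
    apply.\<close>
  unfolding trig_def cis_conv_exp by (cases "L = 0"; force intro!: continuous_intros)

lemma trig_measurable [measurable]: "trig L k \<in> borel_measurable (lebesgue_on S)"
  using borel_measurable_continuous_onI[OF continuous_on_trig[of UNIV L k]]
  by (intro measurable_restrict_space1 measurable_completion) simp

text \<open>Equal values force \<open>x - y\<close> to be an integer multiple of \<open>L\<close>;
  on an interval of length \<open>L\<close> that integer is -1, 0 or 1, and -1 and 1 occur only at
  opposite endpoints. Hence \<open>trig L 1\<close> only glues the endpoints together.\<close>

lemma trig_eq_cases:
  assumes "0 < L" "trig L 1 x = trig L 1 y" "x \<in> {a..a + L}" "y \<in> {a..a + L}"
  shows "x = y \<or> {x, y} = {a, a + L}"
proof -
  have "cis (2 * pi * x / L - 2 * pi * y / L) = 1"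
    using assms(2) by (simp add: trig_def flip: cis_divide)
  then obtain n :: int where "2 * pi * x / L - 2 * pi * y / L = 2 * pi * of_int n"
    by (auto simp: cis_conv_exp exp_eq_1 mult.commute)
  then have "2 * pi * (x - y) = 2 * pi * (of_int n * L)"
    using assms(1) by (simp add: field_simps)
  then have n: "x - y = of_int n * L" by simp
  have "\<bar>x - y\<bar> \<le> L" using assms by auto
  then have "\<bar>real_of_int n\<bar> * L \<le> 1 * L" using assms(1) by (simp add: n abs_mult)
  then have "\<bar>real_of_int n\<bar> \<le> 1" using assms(1) by (rule mult_right_le_imp_le)
  then have "\<bar>n\<bar> \<le> 1" by linarith
  then consider "n = 0" | "n = 1" | "n = -1" by linarith
  then show ?thesis using n assms(3,4) by cases auto
qed

lemma integral_trig:
  assumes "0 < L"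
  shows "(LINT x|lebesgue_on {a..a + L}. trig L k x) = (if k = 0 then of_real L else 0)"
proof (cases "k = 0")
  case True
  then show ?thesis using assms by (simp add: measure_restrict_space scaleR_conv_of_real)
next
  case False
  let ?c = "2 * pi * of_int k / L"
  have c: "?c \<noteq> 0" using False assms by simp
  have int: "integrable (lebesgue_on {a..a + L}) (trig L k)"
    using continuous_imp_integrable_real[OF continuous_on_trig[of "{a..a + L}" L k]] .
  have e: "trig L k x = exp (\<i> * of_real (?c * x))" for x
    by (simp add: trig_def cis_conv_exp)
  let ?F = "\<lambda>x. exp (\<i> * of_real (?c * x)) / (\<i> * of_real ?c)"
  have "(trig L k has_integral (?F (a + L) - ?F a)) {a..a + L}"
  proof (rule fundamental_theorem_of_calculus)
    fix x
    \<comment> \<open>The primitive is differentiated as a function of a complex variable and then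
      restricted to the real line.\<close>
    have "((\<lambda>z. exp (\<i> * (of_real ?c * z)) / (\<i> * of_real ?c)) has_field_derivative
        exp (\<i> * (of_real ?c * of_real x))) (at (of_real x))"
      using c by (auto intro!: derivative_eq_intros)
    from has_vector_derivative_real_field[OF this, of "{a..a + L}"]
    show "(?F has_vector_derivative trig L k x) (at x within {a..a + L})"
      by (simp only: e of_real_mult)
  qed (use assms in simp)
  \<comment> \<open>\<open>L\<close> is a period of the primitive, so its boundary terms
    cancel.\<close>
  moreover have "?F (a + L) = ?F a"
  proof -
    have "2 * pi * of_int k * (a + L) / L = 2 * pi * of_int k * a / L + 2 * pi * of_int k"
      using assms by (simp add: field_simps)
    then have "trig L k (a + L) = trig L k a * cis (2 * pi * of_int k)"
      by (simp only: trig_def cis_mult)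
    then have "trig L k (a + L) = trig L k a" by (simp add: cis_multiple_2pi)
    then show ?thesis by (simp only: e)
  qed
  ultimately have "(trig L k has_integral 0) {a..a + L}" by (simp only: diff_self)
  moreover have "(trig L k has_integral (LINT x|lebesgue_on {a..a + L}. trig L k x)) {a..a + L}"
    by (intro has_integral_integral_lebesgue_on int) simp
  ultimately show ?thesis using False by (metis has_integral_unique)
qed

lemma square_integrable_trig: "square_integrable (lebesgue_on {a..a + L}) (trig L k)"
  by (auto simp: square_integrable_def)

lemma square_integrable_sum_trig:
  assumes "finite F"
  shows "square_integrable (lebesgue_on {a..a + L}) (\<lambda>x. \<Sum>m\<in>F. c m * trig L m x)"
  using assms
proof induction
  case empty
  then show ?case by (simp add: square_integrable_def)
next
  case (insert m F)
  then show ?case by (simp add: square_integrable_add square_integrable_cmult square_integrable_trig)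
qed

text \<open>There is no factor \<open>1 / L\<close>, so that the coefficient has the form of an
  inner product. The coefficients of the orthogonal projection are therefore
  \<open>fourier_coeff a L g m / L\<close>.\<close>

definition fourier_coeff :: "real \<Rightarrow> real \<Rightarrow> (real \<Rightarrow> complex) \<Rightarrow> int \<Rightarrow> complex" where
  "fourier_coeff a L g m = (LINT x|lebesgue_on {a..a + L}. cnj (trig L m x) * g x)"

lemma fourier_coeff_trig:
  assumes "0 < L"
  shows "fourier_coeff a L (trig L k) m = (if k = m then of_real L else 0)"
  using integral_trig[OF assms, of a "- m + k"]
  by (simp add: fourier_coeff_def cnj_trig flip: trig_add)

lemma fourier_coeff_diff:
  assumes "square_integrable (lebesgue_on {a..a + L}) g"
    and "square_integrable (lebesgue_on {a..a + L}) h"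
  shows "fourier_coeff a L (\<lambda>x. g x - c * h x) m = fourier_coeff a L g m - c * fourier_coeff a L h m"
proof -
  have i: "integrable (lebesgue_on {a..a + L}) (\<lambda>x. cnj (trig L m x) * u x)"
    if "square_integrable (lebesgue_on {a..a + L}) u" for u
    by (intro square_integrable_mult_integrable square_integrable_cnj square_integrable_trig that)
  have "fourier_coeff a L (\<lambda>x. g x - c * h x) m
      = (LINT x|lebesgue_on {a..a + L}. cnj (trig L m x) * g x - c * (cnj (trig L m x) * h x))"
    unfolding fourier_coeff_def by (intro Bochner_Integration.integral_cong) (auto simp: algebra_simps)
  then show ?thesis
    using i[OF assms(1)] i[OF assms(2)] by (simp add: fourier_coeff_def)
qed

text \<open>Expand the square and complete it in \<open>c\<close>: the mean square distance is
  smallest at \<open>c = fourier_coeff a L g k / L\<close>.\<close>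

lemma norm_diff_trig_integral:
  assumes L: "0 < L" and g: "square_integrable (lebesgue_on {a..a + L}) g"
  shows "(LINT x|lebesgue_on {a..a + L}. (cmod (g x - c * trig L k x))\<^sup>2)
       = (LINT x|lebesgue_on {a..a + L}. (cmod (g x))\<^sup>2) - (cmod (fourier_coeff a L g k))\<^sup>2 / L
         + L * (cmod (c - fourier_coeff a L g k / L))\<^sup>2"
proof -
  let ?M = "lebesgue_on {a..a + L}"
  let ?z = "fourier_coeff a L g k"
  have i: "integrable ?M (\<lambda>x. cnj (trig L k x) * g x)"
    by (intro square_integrable_mult_integrable square_integrable_cnj square_integrable_trig g)
  have pt: "(cmod (u - c * t))\<^sup>2 = (cmod u)\<^sup>2 - 2 * Re (cnj c * (cnj t * u)) + (cmod c)\<^sup>2"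
    if "cmod t = 1" for u t
  proof -
    have "(cmod (c * t))\<^sup>2 = (cmod c)\<^sup>2" by (simp add: norm_mult that)
    moreover have "(cmod (u - c * t))\<^sup>2 = (cmod u)\<^sup>2 - 2 * Re (cnj (c * t) * u) + (cmod (c * t))\<^sup>2"
      unfolding cmod_power2 by (simp add: algebra_simps power2_eq_square)
    ultimately show ?thesis by (simp add: mult.assoc)
  qed
  have "(LINT x|?M. (cmod (g x - c * trig L k x))\<^sup>2)
     = (LINT x|?M. (cmod (g x))\<^sup>2 - 2 * Re (cnj c * (cnj (trig L k x) * g x)) + (cmod c)\<^sup>2)"
    by (intro Bochner_Integration.integral_cong) (auto simp: pt)
  also have "\<dots> = (LINT x|?M. (cmod (g x))\<^sup>2)
      - 2 * (LINT x|?M. Re (cnj c * (cnj (trig L k x) * g x))) + (cmod c)\<^sup>2 * L"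
  proof -
    have "integrable ?M (\<lambda>x. 2 * Re (cnj c * (cnj (trig L k x) * g x)))"
      by (intro integrable_mult_right integrable_Re i)
    with square_integrable_integrable[OF g]
    have int: "integrable ?M (\<lambda>x. (cmod (g x))\<^sup>2)"
        "integrable ?M (\<lambda>x. 2 * Re (cnj c * (cnj (trig L k x) * g x)))"
        "integrable ?M (\<lambda>x. (cmod c)\<^sup>2)"
      by simp_all
    have "(LINT x|?M. (cmod c)\<^sup>2) = (cmod c)\<^sup>2 * L"
      using L by (simp add: measure_restrict_space)
    then show ?thesis
      using int by (simp only: Bochner_Integration.integral_add Bochner_Integration.integral_diff
          Bochner_Integration.integrable_diff integral_mult_right_zero)
  qed
  also have "(LINT x|?M. Re (cnj c * (cnj (trig L k x) * g x))) = Re (cnj c * ?z)"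
    using i by (subst integral_Re) (auto simp: fourier_coeff_def)
  also have "(LINT x|?M. (cmod (g x))\<^sup>2) - 2 * Re (cnj c * ?z) + (cmod c)\<^sup>2 * L
     = (LINT x|?M. (cmod (g x))\<^sup>2) - (cmod ?z)\<^sup>2 / L + L * (cmod (c - ?z / L))\<^sup>2"
    unfolding cmod_power2 using L by (simp add: field_simps power2_eq_square)
  finally show ?thesis .
qed

text \<open>Characters are subtracted one at a time, which is why the induction generalises over
  \<open>g\<close>. By orthogonality, removing frequency \<open>k\<close> leaves the coefficients at
  the frequencies in \<open>F\<close> unchanged. Both halves of Parseval's identity follow from this
  formula.\<close>

lemma norm_diff_sum_trig_integral:
  assumes L: "0 < L" and g: "square_integrable (lebesgue_on {a..a + L}) g" and "finite F"
  shows "(LINT x|lebesgue_on {a..a + L}. (cmod (g x - (\<Sum>m\<in>F. c m * trig L m x)))\<^sup>2)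
       = (LINT x|lebesgue_on {a..a + L}. (cmod (g x))\<^sup>2) - (\<Sum>m\<in>F. (cmod (fourier_coeff a L g m))\<^sup>2) / L
         + L * (\<Sum>m\<in>F. (cmod (c m - fourier_coeff a L g m / L))\<^sup>2)"
  using assms(3) g
proof (induction arbitrary: g)
  case empty
  then show ?case by simp
next
  case (insert k F)
  let ?h = "\<lambda>x. g x - c k * trig L k x"
  have h: "square_integrable (lebesgue_on {a..a + L}) ?h"
    by (intro square_integrable_diff insert.prems square_integrable_cmult square_integrable_trig)
  have co: "fourier_coeff a L ?h m = fourier_coeff a L g m" if "m \<in> F" for m
    using that insert.hyps
    by (subst fourier_coeff_diff[OF insert.prems square_integrable_trig])
       (auto simp: fourier_coeff_trig[OF L])
  have "(LINT x|lebesgue_on {a..a + L}. (cmod (g x - (\<Sum>m\<in>insert k F. c m * trig L m x)))\<^sup>2)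
      = (LINT x|lebesgue_on {a..a + L}. (cmod (?h x - (\<Sum>m\<in>F. c m * trig L m x)))\<^sup>2)"
    using insert.hyps by (simp add: algebra_simps)
  then show ?case
    using insert.hyps insert.IH[OF h] norm_diff_trig_integral[OF L insert.prems, of "c k" k]
    by (simp add: co algebra_simps add_divide_distrib)
qed

section \<open>Trigonometric polynomials and uniform approximation\<close>

text \<open>Frequencies may repeat, which makes closure under sums and products a plain induction;
  \<open>trig_poly_eq_sum\<close> collects them afterwards.\<close>

inductive trig_poly :: "real \<Rightarrow> (real \<Rightarrow> complex) \<Rightarrow> bool" for L where
  zero: "trig_poly L (\<lambda>x. 0)"
| step: "trig_poly L p \<Longrightarrow> trig_poly L (\<lambda>x. c * trig L k x + p x)"

lemma trig_poly_trig: "trig_poly L (\<lambda>x. c * trig L k x)"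
  using trig_poly.step[OF trig_poly.zero, of L c k] by simp

lemma trig_poly_const: "trig_poly L (\<lambda>x. c)"
  using trig_poly_trig[of L c 0] by simp

lemma trig_poly_add:
  assumes "trig_poly L p" "trig_poly L q"
  shows "trig_poly L (\<lambda>x. p x + q x)"
  using assms(1)
proof induction
  case zero
  then show ?case using assms(2) by simp
next
  case (step p c k)
  from trig_poly.step[OF step.IH, of c k] show ?case by (simp add: add.assoc)
qed

lemma trig_poly_trig_mult:
  assumes "trig_poly L q"
  shows "trig_poly L (\<lambda>x. c * trig L k x * q x)"
  using assms
proof induction
  case zero
  then show ?case by (simp add: trig_poly.zero)
next
  case (step q d j)
  from trig_poly.step[OF step.IH, of "c * d" "k + j"] show ?case
    by (simp add: trig_add algebra_simps)
qed

lemma trig_poly_mult: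
  assumes "trig_poly L p" "trig_poly L q"
  shows "trig_poly L (\<lambda>x. p x * q x)"
  using assms(1)
proof induction
  case zero
  then show ?case by (simp add: trig_poly.zero)
next
  case (step p c k)
  from trig_poly_add[OF trig_poly_trig_mult[OF assms(2), of c k] step.IH] show ?case
    by (simp add: ring_distribs)
qed

lemma trig_poly_eq_sum:
  assumes "trig_poly L p"
  obtains F c where "finite F" "p = (\<lambda>x. \<Sum>m\<in>F. c m * trig L m x)"
proof -
  have "\<exists>F c. finite F \<and> p = (\<lambda>x. \<Sum>m\<in>F. c m * trig L m x)"
    using assms
  proof induction
    case zero
    show ?case by (intro exI[of _ "{}"]) auto
  next
    case (step p d k)
    then obtain F c where F: "finite F" "p = (\<lambda>x. \<Sum>m\<in>F. c m * trig L m x)" by blast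
    \<comment> \<open>\<open>k\<close> may already lie in \<open>F\<close>, so \<open>d\<close> is
      added to the old coefficient; outside \<open>F\<close> the values of \<open>c\<close> are
      arbitrary and are replaced by \<open>0\<close>.\<close>
    define c' where "c' m = (if m \<in> F then c m else 0) + (if m = k then d else 0)" for m
    have "(\<Sum>m\<in>insert k F. c' m * trig L m x)
        = (\<Sum>m\<in>insert k F. if m \<in> F then c m * trig L m x else 0)
          + (\<Sum>m\<in>insert k F. if m = k then d * trig L m x else 0)" for x
      unfolding sum.distrib[symmetric] by (intro sum.cong) (auto simp: c'_def ring_distribs)
    moreover have "(\<Sum>m\<in>insert k F. if m \<in> F then c m * trig L m x else 0) = p x" for x
      unfolding F(2) using F(1) by (intro sum.mono_neutral_cong_right) auto
    ultimately have "(\<Sum>m\<in>insert k F. c' m * trig L m x) = d * trig L k x + p x" for x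
      using F(1) by (simp add: add.commute)
    then show ?case using F(1) by (intro exI[of _ "insert k F"] exI[of _ c']) auto
  qed
  then show ?thesis using that by blast
qed

lemma square_integrable_trig_poly:
  assumes "trig_poly L p"
  shows "square_integrable (lebesgue_on {a..a + L}) p"
  using trig_poly_eq_sum[OF assms] square_integrable_sum_trig by metis

text \<open>A real-linear functional on the complex plane is a combination of \<open>z\<close> and
  \<open>cnj z\<close>, and on the circle these are the characters of frequency 1 and -1. Closure
  under sums and products does the rest.\<close>

lemma trig_poly_real_polynomial:
  assumes "real_polynomial_function h"
  shows "trig_poly L (\<lambda>x. of_real (h (trig L 1 x)))"
  using assms
proof induction
  case (linear h)
  interpret h: bounded_linear h by fact
  have hz: "h z = Re z * h 1 + Im z * h \<i>" for z
  proof -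
    have "h z = h (Re z *\<^sub>R 1 + Im z *\<^sub>R \<i>)"
      by (rule arg_cong[of _ _ h]) (simp add: complex_eq_iff)
    then show ?thesis by (simp only: h.add h.scaleR real_scaleR_def)
  qed
  \<comment> \<open>Substitute \<open>Re z = (z + cnj z) / 2\<close> and
    \<open>Im z = (z - cnj z) / (2 * \<i>)\<close>.\<close>
  have hc: "of_real (h z) = (h 1 - \<i> * h \<i>) / 2 * z + (h 1 + \<i> * h \<i>) / 2 * cnj z" for z
    by (subst hz) (simp add: complex_eq_iff field_simps)
  have "of_real (h (trig L 1 x)) =
      (h 1 - \<i> * h \<i>) / 2 * trig L 1 x + (h 1 + \<i> * h \<i>) / 2 * trig L (-1) x" for x
    by (subst hc) (simp only: cnj_trig)
  moreover have "trig_poly L (\<lambda>x. (h 1 - \<i> * h \<i>) / 2 * trig L 1 x + (h 1 + \<i> * h \<i>) / 2 * trig L (-1) x)"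
    by (intro trig_poly_add trig_poly_trig)
  ultimately show ?case by presburger
next
  case (const c)
  show ?case by (rule trig_poly_const)
qed (simp_all add: trig_poly_add trig_poly_mult)

text \<open>
  Modulo the endpoints, \<open>g\<close> factors through the unit circle as \<open>G\<close>. The graph of \<open>G\<close> is compact, so
  \<open>G\<close> is continuous and the Stone-Weierstrass theorem applies to it.
\<close>

lemma trig_poly_approx_continuous:
  fixes g :: "real \<Rightarrow> complex"
  assumes L: "0 < L" and g: "continuous_on {a..a + L} g" "g a = g (a + L)" and "0 < e"
  obtains p where "trig_poly L p" "\<And>x. x \<in> {a..a + L} \<Longrightarrow> cmod (g x - p x) < e"
proof -
  let ?I = "{a..a + L}" and ?e = "trig L 1"
  define G where "G = g \<circ> inv_into ?I ?e"
  have G: "G (?e x) = g x" if x: "x \<in> ?I" for x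
  proof -
    let ?y = "inv_into ?I ?e (?e x)"
    have "?e ?y = ?e x" by (rule f_inv_into_f[OF imageI[OF x]])
    moreover have "?y \<in> ?I" by (rule inv_into_into[OF imageI[OF x]])
    \<comment> \<open>The chosen preimage may be the opposite endpoint, where \<open>g\<close> takes
      the same value.\<close>
    ultimately have "?y = x \<or> {?y, x} = {a, a + L}"
      using trig_eq_cases[OF L] x by blast
    then have "g ?y = g x" using g(2) by (metis doubleton_eq_iff)
    then show ?thesis by (simp add: G_def)
  qed
  have "continuous_on (?e ` ?I) G"
  proof (rule continuous_from_closed_graph)
    show "compact (g ` ?I)" by (intro compact_continuous_image g) simp
    show "G \<in> ?e ` ?I \<rightarrow> g ` ?I" by (intro funcsetI) (use G in force)
    have "(\<lambda>z. (z, G z)) ` ?e ` ?I = (\<lambda>x. (?e x, g x)) ` ?I"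
      unfolding image_image using G by (intro image_cong refl) simp
    also have "compact \<dots>"
      by (intro compact_continuous_image continuous_intros g) simp
    finally show "closed ((\<lambda>z. (z, G z)) ` ?e ` ?I)" by (rule compact_imp_closed)
  qed
  moreover have "compact (?e ` ?I)"
    by (intro compact_continuous_image continuous_intros) simp
  ultimately obtain q where q: "polynomial_function q" "\<And>z. z \<in> ?e ` ?I \<Longrightarrow> cmod (G z - q z) < e"
    using Stone_Weierstrass_polynomial_function[of "?e ` ?I" G, OF _ _ \<open>0 < e\<close>] by metis
  \<comment> \<open>The approximant is complex-valued, so its real and imaginary parts are treated
    separately and recombined.\<close>
  have "real_polynomial_function (Re \<circ> q)" "real_polynomial_function (Im \<circ> q)"
    using q(1) bounded_linear_Re bounded_linear_Im unfolding polynomial_function_def by blast+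
  from this[THEN trig_poly_real_polynomial, of L]
  have "trig_poly L (\<lambda>x. of_real (Re (q (?e x))) + \<i> * of_real (Im (q (?e x))))"
    by (intro trig_poly_add trig_poly_mult trig_poly_const) (simp_all add: o_def)
  then have "trig_poly L (\<lambda>x. q (?e x))"
    by (simp add: complex_eq[symmetric])
  then show ?thesis
  proof (rule that)
    fix x assume x: "x \<in> ?I"
    have "cmod (G (?e x) - q (?e x)) < e" by (intro q(2) imageI x)
    then show "cmod (g x - q (?e x)) < e" by (simp only: G[OF x])
  qed
qed

section \<open>Mean square density of trigonometric polynomials\<close>

text \<open>A Bochner integral is \<open>0\<close> when its integrand is not integrable, so this
  expresses approximation only for square integrable \<open>g\<close>.\<close>

definition trig_approximable :: "real \<Rightarrow> real \<Rightarrow> (real \<Rightarrow> complex) \<Rightarrow> bool" where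
  "trig_approximable a L g \<longleftrightarrow>
     (\<forall>e>0. \<exists>p. trig_poly L p \<and> (LINT x|lebesgue_on {a..a + L}. (cmod (g x - p x))\<^sup>2) < e)"

lemma trig_approximable_continuous:
  assumes L: "0 < L" and g: "continuous_on {a..a + L} g" "g a = g (a + L)"
  shows "trig_approximable a L g"
  unfolding trig_approximable_def
proof (intro allI impI)
  fix e :: real assume "0 < e"
  \<comment> \<open>Chosen so that \<open>L * ?d\<^sup>2 = e / 2\<close>, which leaves a strict
    inequality.\<close>
  let ?d = "sqrt (e / (2 * L))"
  have "0 < ?d" using L \<open>0 < e\<close> by simp
  then obtain p where p: "trig_poly L p" "\<And>x. x \<in> {a..a + L} \<Longrightarrow> cmod (g x - p x) < ?d"
    using trig_poly_approx_continuous[OF L g] by blast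
  have "(LINT x|lebesgue_on {a..a + L}. (cmod (g x - p x))\<^sup>2) \<le> (LINT x|lebesgue_on {a..a + L}. e / (2 * L))"
  proof (rule integral_mono')
    fix x assume "x \<in> space (lebesgue_on {a..a + L})"
    then have "x \<in> {a..a + L}" by simp
    then have "(cmod (g x - p x))\<^sup>2 \<le> ?d\<^sup>2"
      using p(2)[of x] by (intro power_mono) auto
    then show "(cmod (g x - p x))\<^sup>2 \<le> e / (2 * L)" using L \<open>0 < e\<close> by simp
  qed (use L \<open>0 < e\<close> in auto)
  also have "\<dots> < e" using L \<open>0 < e\<close> by (simp add: measure_restrict_space)
  finally show "\<exists>p. trig_poly L p \<and> (LINT x|lebesgue_on {a..a + L}. (cmod (g x - p x))\<^sup>2) < e"
    using p(1) by blast
qed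

text \<open>Dominated convergence makes \<open>h n\<close> close to \<open>g\<close> in mean square,
  and a trigonometric polynomial is close to \<open>h n\<close>. The lemma is applied twice: from
  continuous to bounded functions, and from bounded to square integrable ones.\<close>

lemma trig_approximable_dominated_limit:
  assumes h: "\<And>n. h n \<in> borel_measurable (lebesgue_on {a..a + L})"
    and g: "square_integrable (lebesgue_on {a..a + L}) g"
    and w: "integrable (lebesgue_on {a..a + L}) w"
    and le: "\<And>n x. x \<in> {a..a + L} \<Longrightarrow> (cmod (g x - h n x))\<^sup>2 \<le> w x"
    and lim: "AE x in lebesgue_on {a..a + L}. (\<lambda>n. h n x) \<longlonglongrightarrow> g x"
    and approx: "\<And>n :: nat. trig_approximable a L (h n)"
  shows "trig_approximable a L g"
  unfolding trig_approximable_def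
proof (intro allI impI)
  fix e :: real assume e: "0 < e"
  let ?M = "lebesgue_on {a..a + L}"
  have gm [measurable]: "g \<in> borel_measurable ?M" by (rule square_integrable_measurable[OF g])
  note h [measurable]
  have "(\<lambda>n. LINT x|?M. (cmod (g x - h n x))\<^sup>2) \<longlonglongrightarrow> (LINT x|?M. 0)"
  proof (rule integral_dominated_convergence)
    show "AE x in ?M. (\<lambda>n. (cmod (g x - h n x))\<^sup>2) \<longlonglongrightarrow> 0"
      using lim
    proof eventually_elim
      case (elim x)
      have "(\<lambda>n. (cmod (g x - h n x))\<^sup>2) \<longlonglongrightarrow> (cmod (g x - g x))\<^sup>2"
        by (intro tendsto_intros elim)
      then show ?case by simp
    qed
    show "AE x in ?M. norm ((cmod (g x - h n x))\<^sup>2) \<le> w x" for n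
      by (rule AE_I2) (simp add: le)
  qed (use w in auto)
  \<comment> \<open>The bound \<open>cmod_power2_add_le\<close> doubles each of the two errors,
    hence a quarter of \<open>e\<close> for each.\<close>
  then have "eventually (\<lambda>n. (LINT x|?M. (cmod (g x - h n x))\<^sup>2) < e / 4) sequentially"
    using e by (intro order_tendstoD(2)[of _ "LINT x|?M. 0"]) auto
  then obtain n where n: "(LINT x|?M. (cmod (g x - h n x))\<^sup>2) < e / 4"
    by (auto simp: eventually_sequentially)
  obtain p where p: "trig_poly L p" "(LINT x|?M. (cmod (h n x - p x))\<^sup>2) < e / 4"
    using approx[of n] e unfolding trig_approximable_def by (meson divide_pos_pos zero_less_numeral)
  have gh: "square_integrable ?M (\<lambda>x. g x - h n x)"
    by (rule square_integrable_dominated[OF _ w]) (auto intro!: AE_I2 le)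
  \<comment> \<open>\<open>h n\<close> is written as \<open>g - (g - h n)\<close>. Integrability
    must be secured here so that the integrals split.\<close>
  have hp: "square_integrable ?M (\<lambda>x. h n x - p x)"
    using square_integrable_diff[OF square_integrable_diff[OF g gh] square_integrable_trig_poly[OF p(1)]]
    by simp
  have "(LINT x|?M. (cmod (g x - p x))\<^sup>2)
      \<le> (LINT x|?M. 2 * (cmod (g x - h n x))\<^sup>2 + 2 * (cmod (h n x - p x))\<^sup>2)"
  proof (rule integral_mono')
    show "integrable ?M (\<lambda>x. 2 * (cmod (g x - h n x))\<^sup>2 + 2 * (cmod (h n x - p x))\<^sup>2)"
      using gh hp by (simp add: square_integrable_def)
    show "(cmod (g x - p x))\<^sup>2 \<le> 2 * (cmod (g x - h n x))\<^sup>2 + 2 * (cmod (h n x - p x))\<^sup>2" for x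
      using cmod_power2_add_le[of "g x - h n x" "h n x - p x"] by simp
  qed simp
  also have "\<dots> = 2 * (LINT x|?M. (cmod (g x - h n x))\<^sup>2) + 2 * (LINT x|?M. (cmod (h n x - p x))\<^sup>2)"
    using gh hp by (simp add: square_integrable_def)
  also have "\<dots> < e" using n p(2) by simp
  finally show "\<exists>p. trig_poly L p \<and> (LINT x|?M. (cmod (g x - p x))\<^sup>2) < e" using p(1) by blast
qed

text \<open>Projection to a disc serves as truncation of complex values: it is continuous and fixes
  the disc pointwise.\<close>

lemma continuous_on_closest_point_cball:
  fixes S :: "complex set" assumes "0 \<le> r"
  shows "continuous_on S (closest_point (cball 0 r))"
  using assms by (intro continuous_on_closest_point) auto

lemma norm_closest_point_cball:
  fixes z :: complex assumes "0 \<le> r"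
  shows "cmod (closest_point (cball 0 r) z) \<le> r"
  using closest_point_in_set[of "cball 0 r" z] assms by auto

text \<open>
  \<open>g\<close> is an almost everywhere limit of continuous functions \<open>u n\<close>. Clamping them to the disc of
  radius \<open>B\<close> permits dominated convergence, and the cutoff makes them periodic.
\<close>

lemma trig_approximable_bounded:
  assumes L: "0 < L" and g: "g \<in> borel_measurable (lebesgue_on {a..a + L})"
    and B: "0 \<le> B" "\<And>x. x \<in> {a..a + L} \<Longrightarrow> cmod (g x) \<le> B"
  shows "trig_approximable a L g"
proof -
  let ?I = "{a..a + L}"
  have "g measurable_on ?I" using g by (subst measurable_on_iff_borel_measurable) auto
  then obtain N u where N: "negligible N" and u: "\<And>n. continuous_on UNIV (u n)"
    and lim: "\<And>x. x \<notin> N \<Longrightarrow> (\<lambda>n. u n x) \<longlonglongrightarrow> (if x \<in> ?I then g x else 0)"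
    unfolding measurable_on_def by metis
  \<comment> \<open>A trapezoid vanishing at both endpoints, which makes \<open>h n\<close> agree
    there; at an interior point it equals 1 once \<open>n\<close> exceeds the reciprocal of the
    distance to the boundary.\<close>
  define cut where "cut n x = max 0 (min 1 (real n * min (x - a) (a + L - x)))" for n x
  define h where "h n x = of_real (cut n x) * closest_point (cball 0 B) (u n x)" for n x
  have cont: "continuous_on S (h n)" for n S
  proof -
    have "continuous_on S (closest_point (cball 0 B) \<circ> u n)"
      by (intro continuous_on_compose continuous_on_closest_point_cball[OF B(1)]
          continuous_on_subset[OF u]) auto
    then show ?thesis unfolding h_def cut_def by (auto intro!: continuous_intros simp: o_def)
  qed
  have hB: "cmod (h n x) \<le> B" for n x
  proof -
    have "cmod (h n x) \<le> 1 * B"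
      unfolding h_def norm_mult
      by (intro mult_mono norm_closest_point_cball B) (auto simp: cut_def)
    then show ?thesis by simp
  qed
  have hlim: "(\<lambda>n. h n x) \<longlonglongrightarrow> g x" if x: "x \<in> {a<..<a + L}" "x \<notin> N" for x
  proof -
    let ?t = "min (x - a) (a + L - x)"
    have t: "0 < ?t" using x by auto
    obtain n0 :: nat where n0: "1 / ?t \<le> real n0" using real_arch_simple by blast
    have "cut n x = 1" if "n0 \<le> n" for n
    proof -
      have "1 / ?t \<le> real n" using n0 that by linarith
      then have "1 \<le> real n * ?t" using t by (simp only: pos_divide_le_eq)
      then show ?thesis by (simp add: cut_def)
    qed
    then have "(\<lambda>n. cut n x) \<longlonglongrightarrow> 1"
      by (intro tendsto_eventually) (auto simp: eventually_sequentially)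
    moreover have "(\<lambda>n. closest_point (cball 0 B) (u n x)) \<longlonglongrightarrow> closest_point (cball 0 B) (g x)"
    proof (rule continuous_on_tendsto_compose[OF continuous_on_closest_point_cball[OF B(1), of UNIV]])
      show "(\<lambda>n. u n x) \<longlonglongrightarrow> g x" using lim[OF x(2)] x(1) by simp
    qed auto
    ultimately have "(\<lambda>n. h n x) \<longlonglongrightarrow> of_real 1 * closest_point (cball 0 B) (g x)"
      unfolding h_def by (intro tendsto_intros)
    moreover have "closest_point (cball 0 B) (g x) = g x"
      using B(2)[of x] x(1) by (intro closest_point_self) auto
    ultimately show ?thesis by simp
  qed
  show ?thesis
  proof (rule trig_approximable_dominated_limit)
    show "h n \<in> borel_measurable (lebesgue_on ?I)" for n
      by (intro continuous_imp_measurable_on_sets_lebesgue cont) simp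
    show "square_integrable (lebesgue_on ?I) g"
      by (rule square_integrable_dominated[where w = "\<lambda>_. B\<^sup>2"])
        (use g B in \<open>auto intro!: AE_I2 power_mono\<close>)
    show "integrable (lebesgue_on ?I) (\<lambda>_. (2 * B)\<^sup>2)" by simp
    show "(cmod (g x - h n x))\<^sup>2 \<le> (2 * B)\<^sup>2" if "x \<in> ?I" for x n
      using norm_triangle_ineq4[of "g x" "h n x"] B(2)[OF that] hB[of n x]
      by (intro power_mono) auto
    \<comment> \<open>The cutoff destroys convergence at the endpoints, so they join the exceptional
      set.\<close>
    have "negligible (N \<union> {a, a + L})" using N by (intro negligible_Un) auto
    then have "AE x in lebesgue. x \<notin> N \<union> {a, a + L}"
      by (auto simp: eventually_ae_filter_negligible)
    then have "AE x in lebesgue. x \<in> ?I \<longrightarrow> (\<lambda>n. h n x) \<longlonglongrightarrow> g x"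
      by eventually_elim (auto intro!: hlim)
    then show "AE x in lebesgue_on ?I. (\<lambda>n. h n x) \<longlonglongrightarrow> g x"
      by (subst AE_restrict_space_iff) auto
    show "trig_approximable a L (h n)" for n
      by (intro trig_approximable_continuous L cont) (use L in \<open>simp add: h_def cut_def\<close>)
  qed
qed

text \<open>Truncating the values of \<open>g\<close> to the disc of radius \<open>n\<close> gives
  bounded functions that eventually equal \<open>g\<close> at each point.\<close>

lemma square_integrable_trig_approximable:
  assumes L: "0 < L" and g: "square_integrable (lebesgue_on {a..a + L}) g"
  shows "trig_approximable a L g"
proof -
  define h where "h n x = closest_point (cball 0 (real n)) (g x)" for n x
  have hm: "h n \<in> borel_measurable (lebesgue_on {a..a + L})" for n
    unfolding h_def
    by (intro borel_measurable_continuous_on[OF continuous_on_closest_point_cball]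
        square_integrable_measurable[OF g]) simp
  show ?thesis
  proof (rule trig_approximable_dominated_limit[OF hm g])
    show "integrable (lebesgue_on {a..a + L}) (\<lambda>x. (2 * cmod (g x))\<^sup>2)"
      using g by (simp add: square_integrable_def power_mult_distrib)
    \<comment> \<open>The projection is 1-Lipschitz and fixes 0.\<close>
    have "cmod (h n x) \<le> cmod (g x)" for n x
      using closest_point_lipschitz[of "cball 0 (real n)" "g x" 0]
        closest_point_self[of 0 "cball (0::complex) (real n)"]
      by (simp add: h_def dist_norm)
    then show "(cmod (g x - h n x))\<^sup>2 \<le> (2 * cmod (g x))\<^sup>2" for n x
      using norm_triangle_ineq4[of "g x" "h n x"]
      by (intro power_mono) (auto intro: order_trans)
    have "(\<lambda>n. h n x) \<longlonglongrightarrow> g x" for x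
    proof (rule tendsto_eventually)
      show "eventually (\<lambda>n. h n x = g x) sequentially"
        using eventually_ge_at_top[of "nat \<lceil>cmod (g x)\<rceil>"]
      proof eventually_elim
        case (elim n)
        then have "cmod (g x) \<le> real n" by linarith
        then show ?case by (simp add: h_def closest_point_self)
      qed
    qed
    then show "AE x in lebesgue_on {a..a + L}. (\<lambda>n. h n x) \<longlonglongrightarrow> g x" by simp
    show "trig_approximable a L (h n)" for n
      by (rule trig_approximable_bounded[OF L hm, of "real n"])
        (auto simp: h_def norm_closest_point_cball)
  qed
qed

text \<open>The optimal coefficients give Bessel's inequality, since a mean square is nonnegative.
  Conversely, for a trigonometric polynomial near \<open>g\<close>, the partial sum over its
  frequencies already nearly exhausts the norm.\<close>

theorem Parseval_trig:
  assumes L: "0 < L" and g: "square_integrable (lebesgue_on {a..a + L}) g"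
  shows "(\<Sum>\<^sub>\<infinity>m\<in>UNIV. ennreal ((cmod (fourier_coeff a L g m))\<^sup>2))
       = ennreal (L * (LINT x|lebesgue_on {a..a + L}. (cmod (g x))\<^sup>2))"
proof -
  let ?M = "lebesgue_on {a..a + L}" and ?c = "fourier_coeff a L g"
  let ?S = "\<lambda>F. \<Sum>m\<in>F. (cmod (?c m))\<^sup>2" and ?I = "LINT x|?M. (cmod (g x))\<^sup>2"
  have SUP: "(\<Sum>\<^sub>\<infinity>m\<in>UNIV. ennreal ((cmod (?c m))\<^sup>2))
      = (SUP F\<in>{F. finite F \<and> F \<subseteq> UNIV}. ennreal (?S F))"
    by (subst nonneg_infsum_complete) (auto simp: sum_ennreal)
  show ?thesis
    unfolding SUP
  proof (rule antisym)
    show "(SUP F\<in>{F. finite F \<and> F \<subseteq> UNIV}. ennreal (?S F)) \<le> ennreal (L * ?I)"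
    proof (rule SUP_least)
      fix F :: "int set" assume "F \<in> {F. finite F \<and> F \<subseteq> UNIV}"
      then have F: "finite F" by simp
      have "0 \<le> (LINT x|?M. (cmod (g x - (\<Sum>m\<in>F. (?c m / L) * trig L m x)))\<^sup>2)"
        by (rule Bochner_Integration.integral_nonneg) simp
      also have "\<dots> = ?I - ?S F / L"
        by (subst norm_diff_sum_trig_integral[OF L g F]) simp
      finally have "?S F \<le> L * ?I" using L by (simp add: field_simps)
      then show "ennreal (?S F) \<le> ennreal (L * ?I)" by (rule ennreal_leI)
    qed
    show "ennreal (L * ?I) \<le> (SUP F\<in>{F. finite F \<and> F \<subseteq> UNIV}. ennreal (?S F))"
    proof (rule ennreal_le_epsilon)
      fix e :: real assume e: "0 < e"
      \<comment> \<open>Multiplication by \<open>L\<close> turns this error into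
        \<open>e\<close>.\<close>
      then have "0 < e / L" using L by simp
      then obtain p where p: "trig_poly L p" "(LINT x|?M. (cmod (g x - p x))\<^sup>2) < e / L"
        using square_integrable_trig_approximable[OF L g] unfolding trig_approximable_def by blast
      obtain F c where F: "finite F" "p = (\<lambda>x. \<Sum>m\<in>F. c m * trig L m x)"
        by (rule trig_poly_eq_sum[OF p(1)])
      have "?I - ?S F / L \<le> ?I - ?S F / L + L * (\<Sum>m\<in>F. (cmod (c m - ?c m / L))\<^sup>2)"
        using L by (simp add: sum_nonneg)
      also have "\<dots> = (LINT x|?M. (cmod (g x - p x))\<^sup>2)"
        unfolding F(2) by (rule norm_diff_sum_trig_integral[OF L g F(1), symmetric])
      finally have "L * ?I \<le> ?S F + e" using p(2) L by (simp add: field_simps)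
      then have "ennreal (L * ?I) \<le> ennreal (?S F) + ennreal e"
        using e by (simp add: sum_nonneg flip: ennreal_plus)
      also have "ennreal (?S F) \<le> (SUP F\<in>{F. finite F \<and> F \<subseteq> UNIV}. ennreal (?S F))"
        by (rule SUP_upper) (use F(1) in simp)
      finally show "ennreal (L * ?I) \<le> (SUP F\<in>{F. finite F \<and> F \<subseteq> UNIV}. ennreal (?S F)) + ennreal e"
        by simp
    qed
  qed
qed

subsection \<open>Coefficients of the Weyl-Heisenberg system\<close>

lemma L2_iff_square_integrable: "f \<in> L2 \<longleftrightarrow> square_integrable lebesgue f"
  by (simp add: L2_def square_integrable_def)

lemma translation_measurable_lebesgue:
  "(\<lambda>x. c + x :: real) \<in> lebesgue \<rightarrow>\<^sub>M lebesgue"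
  using lebesgue_affine_measurable[of "\<lambda>_::real. 1" c] by simp

lemma distr_translation_lebesgue: "distr lebesgue lebesgue (\<lambda>x. c + x :: real) = lebesgue"
  using lebesgue_real_affine[of 1 c] by (simp add: density_1)

lemma AE_lebesgue_translation:
  assumes "AE x in lebesgue. Q (x :: real)"
  shows "AE x in lebesgue. Q (c + x)"
  by (rule AE_distrD[OF translation_measurable_lebesgue])
    (subst distr_translation_lebesgue, rule assms)

lemma square_integrable_translation:
  fixes \<phi> :: "real \<Rightarrow> complex"
  assumes "square_integrable lebesgue \<phi>"
  shows "square_integrable lebesgue (\<lambda>x. \<phi> (c + x))"
  using assms measurable_compose[OF translation_measurable_lebesgue, of \<phi> borel c]
    lebesgue_integrable_real_affine[of "\<lambda>x. (cmod (\<phi> x))\<^sup>2" 1 c]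
  by (simp add: square_integrable_def)

text \<open>The part of the exponent containing \<open>x\<close> is \<open>P * x * m * p0\<close>;
  the choice of \<open>p0\<close> cancels \<open>P\<close> and leaves a character of period
  \<open>\<mu>\<close>. The remaining phase is constant in \<open>x\<close>.\<close>

lemma WH_vector_eq_trig:
  assumes "P \<noteq> 0"
  shows "WH_vector P Q (2 * pi / (P * \<mu>)) q \<phi> m n x =
    cis (P * (of_int m * of_int n * q * (2 * pi / (P * \<mu>)) / 2) + Q * (of_int m * (2 * pi / (P * \<mu>))))
      * trig \<mu> m x * \<phi> (of_int n * q + x)"
proof -
  let ?p = "2 * pi / (P * \<mu>)"
  let ?A = "P * (of_int m * of_int n * q * ?p / 2) + Q * (of_int m * ?p)"
  have "P * (of_int m * of_int n * q * ?p / 2 + x * (of_int m * ?p)) + Q * (of_int m * ?p)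
      = ?A + P * (x * (of_int m * ?p))"
    by (simp only: ring_distribs add_ac)
  also have "P * (x * (of_int m * ?p)) = 2 * pi * of_int m * x / \<mu>"
    using assms by (simp add: field_simps)
  finally show ?thesis
    by (simp only: WH_vector_def WH_rep.simps trig_def cis_mult flip: cis_conv_exp)
qed

lemma integral_lebesgue_on_AE_zero:
  fixes u :: "real \<Rightarrow> 'b :: {banach, second_countable_topology}"
  assumes "S \<in> sets lebesgue" "u \<in> borel_measurable lebesgue"
    and zero: "AE x in lebesgue. x \<notin> S \<longrightarrow> u x = 0"
  shows "(LINT x|lebesgue_on S. u x) = (LINT x|lebesgue. u x)"
proof -
  note [measurable] = assms(1,2)
  have "(LINT x|lebesgue_on S. u x) = (LINT x|lebesgue. indicator S x *\<^sub>R u x)"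
    using assms(1) by (simp add: integral_restrict_space)
  also have "\<dots> = (LINT x|lebesgue. u x)"
  proof (rule integral_cong_AE)
    show "AE x in lebesgue. indicator S x *\<^sub>R u x = u x"
      using zero by eventually_elim (auto simp: indicator_def)
  qed measurable
  finally show ?thesis .
qed

lemma frame_coefficients_sum_over_modulations:
  assumes "P \<noteq> 0" and \<mu>: "0 < \<mu>"
    and f: "square_integrable lebesgue f" and \<phi>: "square_integrable lebesgue \<phi>"
    and bounded: "AE x in lebesgue. (cmod (\<phi> x))\<^sup>2 \<le> B"
    and supp: "AE x in lebesgue. x \<notin> {a..a + \<mu>} \<longrightarrow> \<phi> x = 0"
  shows "(\<Sum>\<^sub>\<infinity>m\<in>UNIV. ennreal ((cmod (L2_inner f (WH_vector P Q (2 * pi / (P * \<mu>)) q \<phi> m n)))\<^sup>2))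
       = ennreal \<mu> * (\<integral>\<^sup>+x. ennreal ((cmod (f x))\<^sup>2) * ennreal ((cmod (\<phi> (of_int n * q + x)))\<^sup>2) \<partial>lebesgue)"
proof -
  let ?c = "of_int n * q"
  define h where "h x = f x * cnj (\<phi> (?c + x))" for x
  \<comment> \<open>The condition that \<open>?c + x\<close> lies in \<open>{a..a + \<mu>}\<close>
    says that \<open>x\<close> lies in \<open>?I\<close>.\<close>
  define b where "b = a - ?c"
  let ?I = "{b..b + \<mu>}"
  have fm [measurable]: "f \<in> borel_measurable lebesgue"
    by (rule square_integrable_measurable[OF f])
  have hm [measurable]: "h \<in> borel_measurable lebesgue"
    unfolding h_def
    by (intro borel_measurable_times fm square_integrable_measurable[OF
        square_integrable_cnj[OF square_integrable_translation[OF \<phi>]]])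
  have norm_h: "(cmod (h x))\<^sup>2 = (cmod (f x))\<^sup>2 * (cmod (\<phi> (?c + x)))\<^sup>2" for x
    by (simp add: h_def norm_mult power_mult_distrib)
  have h: "square_integrable lebesgue h"
  proof (rule square_integrable_dominated[OF hm])
    show "integrable lebesgue (\<lambda>x. (cmod (f x))\<^sup>2 * B)"
      using square_integrable_integrable[OF f] by simp
    show "AE x in lebesgue. (cmod (h x))\<^sup>2 \<le> (cmod (f x))\<^sup>2 * B"
      using AE_lebesgue_translation[OF bounded, of ?c]
      by eventually_elim (auto simp: norm_h intro!: mult_left_mono)
  qed
  then have h_on: "square_integrable (lebesgue_on ?I) h"
    by (auto simp: square_integrable_def integrable_restrict_space measurable_restrict_space1
        intro!: integrable_mult_indicator[of ?I lebesgue "\<lambda>x. (cmod (h x))\<^sup>2", simplified])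
  have h_zero: "AE x in lebesgue. x \<notin> ?I \<longrightarrow> h x = 0"
    using AE_lebesgue_translation[OF supp, of ?c]
    by eventually_elim (auto simp: h_def b_def)
  have coeff: "cmod (L2_inner f (WH_vector P Q (2 * pi / (P * \<mu>)) q \<phi> m n)) = cmod (fourier_coeff b \<mu> h m)"
    for m
  proof -
    define \<theta> where "\<theta> = P * (of_int m * of_int n * q * (2 * pi / (P * \<mu>)) / 2) + Q * (of_int m * (2 * pi / (P * \<mu>)))"
    have tm [measurable]: "trig \<mu> m \<in> borel_measurable lebesgue"
      using trig_measurable[of \<mu> m UNIV] by (simp add: lebesgue_on_UNIV_eq)
    have tm' [measurable]: "(\<lambda>x. cnj (trig \<mu> m x)) \<in> borel_measurable lebesgue"
      unfolding cnj_trig using trig_measurable[of \<mu> "- m" UNIV] by (simp add: lebesgue_on_UNIV_eq)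
    \<comment> \<open>\<open>L2_inner\<close> conjugates \<open>f\<close>, while \<open>h\<close>
      conjugates \<open>\<phi>\<close>; hence the outer conjugation, which the modulus
      ignores.\<close>
    have "L2_inner f (WH_vector P Q (2 * pi / (P * \<mu>)) q \<phi> m n)
        = (LINT x|lebesgue. cis \<theta> * cnj (cnj (trig \<mu> m x) * h x))"
      unfolding L2_inner_def WH_vector_eq_trig[OF assms(1)] \<theta>_def[symmetric]
      by (intro Bochner_Integration.integral_cong) (auto simp: h_def)
    also have "\<dots> = cis \<theta> * cnj (LINT x|lebesgue. cnj (trig \<mu> m x) * h x)"
      by (simp only: integral_mult_right_zero Bochner_Integration.integral_cnj)
    also have "(LINT x|lebesgue. cnj (trig \<mu> m x) * h x) = fourier_coeff b \<mu> h m"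
      unfolding fourier_coeff_def
    proof (rule integral_lebesgue_on_AE_zero[symmetric])
      show "AE x in lebesgue. x \<notin> ?I \<longrightarrow> cnj (trig \<mu> m x) * h x = 0"
        using h_zero by eventually_elim auto
    qed auto
    finally show ?thesis by (simp add: norm_mult)
  qed
  have "(\<Sum>\<^sub>\<infinity>m\<in>UNIV. ennreal ((cmod (L2_inner f (WH_vector P Q (2 * pi / (P * \<mu>)) q \<phi> m n)))\<^sup>2))
      = ennreal (\<mu> * (LINT x|lebesgue_on ?I. (cmod (h x))\<^sup>2))"
    unfolding coeff by (rule Parseval_trig[OF \<mu> h_on])
  also have "(LINT x|lebesgue_on ?I. (cmod (h x))\<^sup>2) = (LINT x|lebesgue. (cmod (h x))\<^sup>2)"
  proof (rule integral_lebesgue_on_AE_zero)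
    show "AE x in lebesgue. x \<notin> ?I \<longrightarrow> (cmod (h x))\<^sup>2 = 0"
      using h_zero by eventually_elim auto
  qed auto
  also have "ennreal (\<mu> * \<dots>) = ennreal \<mu> * (\<integral>\<^sup>+x. ennreal ((cmod (h x))\<^sup>2) \<partial>lebesgue)"
    using \<mu> square_integrable_integrable[OF h]
    by (subst nn_integral_eq_integral) (auto simp: ennreal_mult'')
  also have "(\<integral>\<^sup>+x. ennreal ((cmod (h x))\<^sup>2) \<partial>lebesgue)
      = (\<integral>\<^sup>+x. ennreal ((cmod (f x))\<^sup>2) * ennreal ((cmod (\<phi> (?c + x)))\<^sup>2) \<partial>lebesgue)"
    by (simp add: norm_h ennreal_mult)
  finally show ?thesis .
qed

text \<open>The representation translates by \<open>+ n * q\<close>, whereas the hypothesis of the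
  theorem uses \<open>- n * q\<close>; this reconciles the two.\<close>

lemma infsum_int_uminus:
  fixes u :: "int \<Rightarrow> ennreal"
  shows "(\<Sum>\<^sub>\<infinity>n\<in>UNIV. u (- n)) = (\<Sum>\<^sub>\<infinity>n\<in>UNIV. u n)"
  by (rule infsum_reindex_bij_betw) (rule bij_uminus)

text \<open>Sum the previous identity over \<open>n\<close> and exchange sum and integral by
  Tonelli, all terms being nonnegative.\<close>

lemma frame_coefficients_sum:
  assumes P: "P \<noteq> 0" and \<mu>: "0 < \<mu>"
    and f: "square_integrable lebesgue f" and \<phi>: "square_integrable lebesgue \<phi>"
    and bounded: "AE x in lebesgue. (cmod (\<phi> x))\<^sup>2 \<le> B"
    and supp: "AE x in lebesgue. x \<notin> {a..a + \<mu>} \<longrightarrow> \<phi> x = 0"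
  shows "(\<Sum>\<^sub>\<infinity>(m, n)\<in>UNIV. ennreal ((cmod (L2_inner f (WH_vector P Q (2 * pi / (P * \<mu>)) q \<phi> m n)))\<^sup>2))
       = ennreal \<mu> * (\<integral>\<^sup>+x. ennreal ((cmod (f x))\<^sup>2)
           * (\<Sum>\<^sub>\<infinity>n\<in>UNIV. ennreal ((cmod (\<phi> (x - of_int n * q)))\<^sup>2)) \<partial>lebesgue)"
proof -
  have fm [measurable]: "f \<in> borel_measurable lebesgue"
    by (rule square_integrable_measurable[OF f])
  have \<phi>m [measurable]: "(\<lambda>x. \<phi> (c + x)) \<in> borel_measurable lebesgue" for c
    by (rule square_integrable_measurable[OF square_integrable_translation[OF \<phi>]])
  let ?u = "\<lambda>n x. ennreal ((cmod (\<phi> (of_int n * q + x)))\<^sup>2)"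
  have sum: "(\<Sum>\<^sub>\<infinity>n\<in>UNIV. ?u n x) = (\<Sum>\<^sub>\<infinity>n\<in>UNIV. ennreal ((cmod (\<phi> (x - of_int n * q)))\<^sup>2))" for x
    using infsum_int_uminus[of "\<lambda>n. ?u n x"] by simp
  have "(\<Sum>\<^sub>\<infinity>(m, n)\<in>UNIV. ennreal ((cmod (L2_inner f (WH_vector P Q (2 * pi / (P * \<mu>)) q \<phi> m n)))\<^sup>2))
      = (\<integral>\<^sup>+n. ennreal \<mu> * (\<integral>\<^sup>+x. ennreal ((cmod (f x))\<^sup>2) * ?u n x \<partial>lebesgue) \<partial>count_space UNIV)"
    unfolding infsum_int_int_ennreal
      frame_coefficients_sum_over_modulations[OF P \<mu> f \<phi> bounded supp]
    by (rule infsum_int_eq_nn_integral)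
  also have "\<dots> = ennreal \<mu> * (\<integral>\<^sup>+n. (\<integral>\<^sup>+x. ennreal ((cmod (f x))\<^sup>2) * ?u n x \<partial>lebesgue) \<partial>count_space UNIV)"
    by (intro nn_integral_cmult) simp
  also have "(\<integral>\<^sup>+n. (\<integral>\<^sup>+x. ennreal ((cmod (f x))\<^sup>2) * ?u n x \<partial>lebesgue) \<partial>count_space UNIV)
      = (\<integral>\<^sup>+x. (\<integral>\<^sup>+n. ennreal ((cmod (f x))\<^sup>2) * ?u n x \<partial>count_space UNIV) \<partial>lebesgue)"
    by (intro nn_integral_count_space_nn_integral[symmetric]) auto
  also have "\<dots> = (\<integral>\<^sup>+x. ennreal ((cmod (f x))\<^sup>2) * (\<Sum>\<^sub>\<infinity>n\<in>UNIV. ?u n x) \<partial>lebesgue)"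
    by (intro nn_integral_cong) (simp add: nn_integral_cmult infsum_int_eq_nn_integral)
  finally show ?thesis by (simp only: sum)
qed

section \<open>Membership in \<open>L2\<close> and the frame inequality\<close>

lemma WH_vector_in_L2:
  assumes "\<phi> \<in> L2"
  shows "WH_vector P Q p q \<phi> m n \<in> L2"
proof -
  have eq: "WH_vector P Q p q \<phi> m n = (\<lambda>x. exp (\<i> * complex_of_real
      (P * (of_int m * of_int n * q * p / 2 + x * (of_int m * p)) + Q * (of_int m * p)))
      * \<phi> (of_int n * q + x))" (is "_ = (\<lambda>x. ?e x * _)")
    by (auto simp: WH_vector_def)
  have e: "cmod (?e x) = 1" for x by (rule norm_exp_i_times)
  have "continuous_on UNIV ?e" by (intro continuous_intros)
  then have "?e \<in> borel_measurable lebesgue"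
    by (intro measurable_completion) (simp add: borel_measurable_continuous_onI)
  moreover have \<phi>: "square_integrable lebesgue (\<lambda>x. \<phi> (of_int n * q + x))"
    using assms by (intro square_integrable_translation) (simp add: L2_iff_square_integrable)
  ultimately have "(\<lambda>x. ?e x * \<phi> (of_int n * q + x)) \<in> borel_measurable lebesgue"
    by (rule borel_measurable_times[OF _ square_integrable_measurable])
  with square_integrable_integrable[OF \<phi>] show ?thesis
    unfolding L2_iff_square_integrable eq square_integrable_def norm_mult e
    by simp
qed

lemma L2_norm_eq_nn_integral:
  assumes "f \<in> L2"
  shows "(\<integral>\<^sup>+x. ennreal ((cmod (f x))\<^sup>2) \<partial>lebesgue) = ennreal ((L2_norm f)\<^sup>2)"
  using assms by (subst nn_integral_eq_integral) (auto simp: L2_def L2_norm_def)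

theorem theorem3p2:
  fixes N :: nat and P Q \<alpha> \<beta> :: real
    and \<mu> q0 p0 :: "nat \<Rightarrow> real" and \<phi> :: "nat \<Rightarrow> real \<Rightarrow> complex"
  assumes "N \<ge> 1" and "P \<noteq> 0" and "\<alpha> > 0" and "\<beta> > 0"
    and "\<And>l. l \<in> {1..N} \<Longrightarrow> \<mu> l > 0"
    and "\<And>l. l \<in> {1..N} \<Longrightarrow> \<phi> l \<in> L2"
    and "\<And>l. l \<in> {1..N} \<Longrightarrow> \<not> (AE x in lebesgue. \<phi> l x = 0)"
    and "\<And>l. l \<in> {1..N} \<Longrightarrow> \<exists>a. L2_support (\<phi> l) \<subseteq> {a..a + \<mu> l}"
    and "\<And>l. l \<in> {1..N} \<Longrightarrow> p0 l = 2 * pi / (P * \<mu> l)"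
    and "\<And>l. l \<in> {1..N} \<Longrightarrow> \<bar>q0 l * p0 l\<bar> < 2 * pi"
    and "\<And>l. l \<in> {1..N} \<Longrightarrow> AE x in lebesgue.
           ennreal (\<alpha> / (real N * Min (\<mu> ` {1..N})))
             \<le> (\<Sum>\<^sub>\<infinity>n\<in>UNIV. ennreal ((cmod (\<phi> l (x - of_int n * q0 l)))\<^sup>2)) \<and>
           (\<Sum>\<^sub>\<infinity>n\<in>UNIV. ennreal ((cmod (\<phi> l (x - of_int n * q0 l)))\<^sup>2))
             \<le> ennreal (\<beta> / (real N * Max (\<mu> ` {1..N})))"
  shows "L2_multivariate_frame N
           (\<lambda>m n l. WH_vector P Q (p0 l) (q0 l) (\<phi> l) m n) \<alpha> \<beta>"
proof -
  let ?S = "\<lambda>l x. \<Sum>\<^sub>\<infinity>n\<in>UNIV. ennreal ((cmod (\<phi> l (x - of_int n * q0 l)))\<^sup>2)"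
  let ?A = "\<alpha> / (real N * Min (\<mu> ` {1..N}))" and ?B = "\<beta> / (real N * Max (\<mu> ` {1..N}))"
  let ?T = "\<lambda>f l. \<Sum>\<^sub>\<infinity>(m, n)\<in>UNIV. ennreal ((cmod (L2_inner f (WH_vector P Q (p0 l) (q0 l) (\<phi> l) m n)))\<^sup>2)"
  have N: "real N > 0" using assms(1) by simp
  have Min: "0 < Min (\<mu> ` {1..N})"
    using assms(1,5) by (subst Min_gr_iff) auto
  have Max: "0 < Max (\<mu> ` {1..N})"
    using assms(1,5) by (subst Max_gr_iff) force+
  have A: "0 \<le> ?A" by (rule divide_nonneg_pos[OF less_imp_le[OF assms(3)] mult_pos_pos[OF N Min]])
  have B: "0 \<le> ?B" by (rule divide_nonneg_pos[OF less_imp_le[OF assms(4)] mult_pos_pos[OF N Max]])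
  \<comment> \<open>Each window alone contributes between \<open>\<alpha> / N\<close> and
    \<open>\<beta> / N\<close> times the squared norm.\<close>
  have bounds: "ennreal (\<alpha> * (L2_norm f)\<^sup>2 / N) \<le> ?T f l \<and> ?T f l \<le> ennreal (\<beta> * (L2_norm f)\<^sup>2 / N)"
    if l: "l \<in> {1..N}" and f: "f \<in> L2" for f l
  proof -
    note AE = assms(11)[OF l]
    have \<mu>: "0 < \<mu> l" by (rule assms(5)[OF l])
    have fm [measurable]: "f \<in> borel_measurable lebesgue" using f by (simp add: L2_def)
    \<comment> \<open>The term \<open>n = 0\<close> of the sum in the upper bound already dominates
      the window itself.\<close>
    have "AE x in lebesgue. (cmod (\<phi> l x))\<^sup>2 \<le> ?B"
      using AE
    proof eventually_elim
      case (elim x)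
      have "ennreal ((cmod (\<phi> l x))\<^sup>2) = (\<Sum>n\<in>{0}. ennreal ((cmod (\<phi> l (x - of_int n * q0 l)))\<^sup>2))"
        by simp
      also have "\<dots> \<le> ?S l x"
        by (subst nonneg_infsum_complete, simp) (rule SUP_upper, simp)
      also have "\<dots> \<le> ennreal ?B" using elim by blast
      finally show ?case
        by (simp only: ennreal_le_iff[OF B])
    qed
    moreover obtain a where a: "L2_support (\<phi> l) \<subseteq> {a..a + \<mu> l}" using assms(8)[OF l] by blast
    have "AE x in lebesgue. x \<notin> {a..a + \<mu> l} \<longrightarrow> \<phi> l x = 0"
      using AE_L2_support_complement[of "\<phi> l"] by eventually_elim (use a in blast)
    ultimately have T: "?T f l = ennreal (\<mu> l) * (\<integral>\<^sup>+x. ennreal ((cmod (f x))\<^sup>2) * ?S l x \<partial>lebesgue)"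
      unfolding assms(9)[OF l]
      using frame_coefficients_sum[OF assms(2) \<mu>] f assms(6)[OF l]
      unfolding L2_iff_square_integrable by blast
    have const: "ennreal (\<mu> l) * (\<integral>\<^sup>+x. ennreal ((cmod (f x))\<^sup>2) * ennreal c \<partial>lebesgue)
        = ennreal (\<mu> l * c * (L2_norm f)\<^sup>2)" if "0 \<le> c" for c
      using \<mu> that
      by (subst nn_integral_multc)
        (auto simp: L2_norm_eq_nn_integral[OF f] ennreal_mult' mult_ac)
    \<comment> \<open>The minimum in \<open>?A\<close> is at most \<open>\<mu> l\<close>, so the
      factor \<open>\<mu> l\<close> from Parseval absorbs it; the maximum in \<open>?B\<close> plays
      the dual part.\<close>
    have "\<alpha> * (L2_norm f)\<^sup>2 / N \<le> \<mu> l * ?A * (L2_norm f)\<^sup>2"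
    proof -
      have "Min (\<mu> ` {1..N}) \<le> \<mu> l" using l by simp
      then have "\<alpha> / N \<le> \<mu> l * ?A" using Min N assms(3) by (simp add: field_simps)
      from mult_right_mono[OF this, of "(L2_norm f)\<^sup>2"] show ?thesis by simp
    qed
    then have "ennreal (\<alpha> * (L2_norm f)\<^sup>2 / N) \<le> ennreal (\<mu> l * ?A * (L2_norm f)\<^sup>2)"
      by (rule ennreal_leI)
    also have "\<dots> = ennreal (\<mu> l) * (\<integral>\<^sup>+x. ennreal ((cmod (f x))\<^sup>2) * ennreal ?A \<partial>lebesgue)"
      by (rule const[OF A, symmetric])
    also have "\<dots> \<le> ?T f l"
      unfolding T
    proof (intro mult_left_mono nn_integral_mono_AE)
      show "AE x in lebesgue. ennreal ((cmod (f x))\<^sup>2) * ennreal ?A \<le> ennreal ((cmod (f x))\<^sup>2) * ?S l x"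
        using AE by eventually_elim (auto intro: mult_left_mono)
    qed simp
    finally have lower: "ennreal (\<alpha> * (L2_norm f)\<^sup>2 / N) \<le> ?T f l" .
    have "?T f l \<le> ennreal (\<mu> l) * (\<integral>\<^sup>+x. ennreal ((cmod (f x))\<^sup>2) * ennreal ?B \<partial>lebesgue)"
      unfolding T
    proof (intro mult_left_mono nn_integral_mono_AE)
      show "AE x in lebesgue. ennreal ((cmod (f x))\<^sup>2) * ?S l x \<le> ennreal ((cmod (f x))\<^sup>2) * ennreal ?B"
        using AE by eventually_elim (auto intro: mult_left_mono)
    qed simp
    also have "\<dots> = ennreal (\<mu> l * ?B * (L2_norm f)\<^sup>2)"
      by (rule const[OF B])
    also have "\<dots> \<le> ennreal (\<beta> * (L2_norm f)\<^sup>2 / N)"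
    proof (rule ennreal_leI)
      have "\<mu> l \<le> Max (\<mu> ` {1..N})" using l by simp
      then have "\<mu> l * ?B \<le> \<beta> / N" using Max N assms(4) by (simp add: field_simps)
      from mult_right_mono[OF this, of "(L2_norm f)\<^sup>2"]
      show "\<mu> l * ?B * (L2_norm f)\<^sup>2 \<le> \<beta> * (L2_norm f)\<^sup>2 / N" by simp
    qed
    finally show ?thesis using lower by blast
  qed
  \<comment> \<open>Splitting the bound into \<open>N\<close> equal shares allows a comparison term
    by term.\<close>
  have const: "ennreal (c * (L2_norm f)\<^sup>2) = (\<Sum>l=1..N. ennreal (c * (L2_norm f)\<^sup>2 / N))" if "0 < c" for c f
    using N that by (subst sum_ennreal) auto
  have "ennreal (\<alpha> * (L2_norm f)\<^sup>2) \<le> (\<Sum>l=1..N. ?T f l)"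
    "(\<Sum>l=1..N. ?T f l) \<le> ennreal (\<beta> * (L2_norm f)\<^sup>2)" if "f \<in> L2" for f
    unfolding const[OF assms(3)] const[OF assms(4)]
    by (intro sum_mono; use bounds that in blast)+
  then show ?thesis
    unfolding L2_multivariate_frame_def
    using assms(3,4,6) WH_vector_in_L2 by blast
qed

end
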